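(* Let $G$ be a finite simple graph and let $A \subseteq B \subseteq V(G)$. Then $b_{\rm g}(G \vert B) \leq b_{\rm g}(G \vert A)$.
   Context: The burning game on a finite simple graph $G$ is played by two players, Burner and Staller. Each vertex is either burned or unburned, and once burned it stays burned. In round 1 the starting player chooses one unburned vertex and burns it (selection phase only). Each round $t \ge 2$ consists of a spreading phase, in which every unburned vertex with a burned neighbor becomes burned, followed, if unburned vertices remain, by a selection phase in which the player whose turn it is burns one unburned vertex; the two players make the selections alternately. The game ends in the first round in which all vertices are burned (this may happen right after a spreading phase), and its length is the number of that round. Burner wants to minimize the length and Staller to maximize it. For $B \subseteq V(G)$, $G \vert B$ denotes the burning game on $G$ in which the vertices of $B$ are already burned before round 1 (otherwise the rules are the same). $b_{\rm g}(G \vert B)$ is the length of this game under optimal play of both players when Burner makes the first selection. *)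

theory Defs
  imports "Graph_Theory.Digraph"
begin

datatype player = Burner | Staller

fun opponent :: "player \<Rightarrow> player" where
  "opponent Burner = Staller"
| "opponent Staller = Burner"

fun optimum :: "player \<Rightarrow> nat set \<Rightarrow> nat" where
  "optimum Burner N = Min N"
| "optimum Staller N = Max N"

context pre_digraph
begin

definition spread :: "'a set \<Rightarrow> 'a set" where
  "spread S = S \<union> {v \<in> verts G. \<exists>u \<in> S. u \<rightarrow> v}"

lemma subset_spread: "S \<subseteq> spread S"
  by (simp add: spread_def)

end

text \<open>
  The locale \<^locale>\<open>graph\<close> describes finite simple graphs, with every edge represented
  by its two orientations.
\<close>

context graph
begin

lemma card_unburned_decreases:
  assumes "S \<subseteq> T" "v \<in> verts G" "v \<notin> T"
  shows "card (verts G - insert v T) < card (verts G - S)"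
  using assms by (intro psubset_card_mono) auto

text \<open>
  The value, by backward induction, of a position at the end of a round: \<open>further_rounds p S\<close> is
  the number of rounds still to be played when \<open>S\<close> is the set of burned vertices and \<open>p\<close> makes the
  next selection, both players playing optimally. Each of these rounds begins with a spreading
  phase; if that burns everything, the game ends with this round and nothing is selected.
\<close>

function further_rounds :: "player \<Rightarrow> 'a set \<Rightarrow> nat" where
  "further_rounds p S =
     (if verts G \<subseteq> S then 0
      else if verts G \<subseteq> spread S then 1
      else 1 + optimum p ((\<lambda>v. further_rounds (opponent p) (insert v (spread S)))
                            ` (verts G - spread S)))"
  by pat_completeness auto

termination
proof (relation "measure (\<lambda>(p, S). card (verts G - S))")
  fix p S v assume "v \<in> verts G - spread S"
  then have "card (verts G - insert v (spread S)) < card (verts G - S)"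
    by (intro card_unburned_decreases subset_spread) auto
  then show "((opponent p, insert v (spread S)), (p, S)) \<in> measure (\<lambda>(p, S). card (verts G - S))"
    by (simp del: Diff_insert)
qed simp

declare further_rounds.simps [simp del]

text \<open>
  \<open>game_length p B\<close> is the length of the game on \<open>G | B\<close> in which \<open>p\<close> makes the first selection.
  Round 1 has no spreading phase, even if \<open>B\<close> is nonempty. If all vertices are already in \<open>B\<close>, there
  is nothing to play and the length is 0.
\<close>

definition game_length :: "player \<Rightarrow> 'a set \<Rightarrow> nat" where
  "game_length p B =
     (if verts G \<subseteq> B then 0
      else 1 + optimum p ((\<lambda>v. further_rounds (opponent p) (insert v B)) ` (verts G - B)))"

definition b\<^sub>g :: "'a set \<Rightarrow> nat" where
  "b\<^sub>g B = game_length Burner B"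

end

end

theory Submission
  imports Defs
begin

text \<open>
  Burning more vertices never hurts Burner: a selection of Staller in the position with more
  burned vertices is also available in the other one, and Burner can copy his selection from the
  position with fewer burned vertices, or select anything if that vertex is already burned. Either
  way the inclusion between the burned sets persists.
\<close>

lemma optimum_selection_le:
  fixes f :: "'a set \<Rightarrow> nat"
  assumes "finite V" "S \<subseteq> T" "\<not> V \<subseteq> T"
    and le: "\<And>v U. v \<in> V - S \<Longrightarrow> insert v S \<subseteq> U \<Longrightarrow> f U \<le> f (insert v S)"
  shows "optimum p ((\<lambda>v. f (insert v T)) ` (V - T)) \<le> optimum p ((\<lambda>v. f (insert v S)) ` (V - S))"
    (is "optimum p ?NT \<le> optimum p ?NS")
proof -
  have fin: "finite ?NT" "finite ?NS" using \<open>finite V\<close> by auto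
  have ne: "?NT \<noteq> {}" "?NS \<noteq> {}" using assms(2,3) by auto
  show ?thesis
  proof (cases p)
    case Burner
    have "Min ?NS \<in> ?NS" using fin ne by (intro Min_in)
    then obtain v where v: "v \<in> V - S" "Min ?NS = f (insert v S)" by blast
    \<comment> \<open>Take \<open>w = v\<close> if \<open>v\<close> is outside \<open>T\<close>, and
      any vertex of \<open>V - T\<close> otherwise. In the latter case \<open>insert w T\<close>
      differs from \<open>insert v T\<close>, which is why \<open>le\<close> covers every superset
      \<open>U\<close>.\<close>
    obtain w where w: "w \<in> V - T" "v \<in> insert w T" using assms(3) v(1) by blast
    have "Min ?NT \<le> f (insert w T)" using fin w(1) by (intro Min_le) auto
    also have "\<dots> \<le> f (insert v S)" using v(1) w(2) \<open>S \<subseteq> T\<close> by (intro le) auto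
    finally show ?thesis using Burner v(2) by simp
  next
    case Staller
    have "Max ?NT \<in> ?NT" using fin ne by (intro Max_in)
    then obtain v where v: "v \<in> V - T" "Max ?NT = f (insert v T)" by blast
    have "f (insert v T) \<le> f (insert v S)" using v(1) \<open>S \<subseteq> T\<close> by (intro le) auto
    also have "\<dots> \<le> Max ?NS" using fin v(1) \<open>S \<subseteq> T\<close> by (intro Max_ge) auto
    finally show ?thesis using Staller v(2) by simp
  qed
qed

lemma (in pre_digraph) spread_mono: "S \<subseteq> T \<Longrightarrow> spread S \<subseteq> spread T"
  by (auto simp: spread_def)

context graph
begin

text \<open>Induction along the recursion at \<open>S\<close>: spreading preserves the inclusion,
  and comparing the selections carries it through the rest of the round.\<close>

lemma further_rounds_antimono:
  "S \<subseteq> T \<Longrightarrow> further_rounds p T \<le> further_rounds p S"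
proof (induction p S arbitrary: T rule: further_rounds.induct)
  case (1 p S)
  have sub: "spread S \<subseteq> spread T" using 1(2) by (rule spread_mono)
  show ?case
  \<comment> \<open>If \<open>S\<close> covers all vertices, both values are 0. Otherwise the value
    at \<open>S\<close> is at least 1, which suffices once \<open>spread T\<close> covers
    everything.\<close>
  proof (cases "verts G \<subseteq> S \<or> verts G \<subseteq> spread T")
    case True
    then show ?thesis
      using \<open>S \<subseteq> T\<close> by (subst (1 2) further_rounds.simps) auto
  next
    case False
    then have open_game: "\<not> verts G \<subseteq> S" "\<not> verts G \<subseteq> T" "\<not> verts G \<subseteq> spread S"
      "\<not> verts G \<subseteq> spread T"
      using sub subset_spread[of T] by auto
    \<comment> \<open>With \<open>T\<close> arbitrary, the induction hypothesis is the premise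
      \<open>le\<close> for \<open>f = further_rounds (opponent p)\<close>.\<close>
    have "optimum p ((\<lambda>v. further_rounds (opponent p) (insert v (spread T))) ` (verts G - spread T))
        \<le> optimum p ((\<lambda>v. further_rounds (opponent p) (insert v (spread S))) ` (verts G - spread S))"
      using open_game sub 1(1) by (intro optimum_selection_le) auto
    then show ?thesis
      using open_game by (subst (1 2) further_rounds.simps) simp
  qed
qed

text \<open>Round 1 has no spreading phase, so its selections are compared separately, from
  \<open>S\<close> and \<open>T\<close> themselves; the later rounds are covered by
  \<open>further_rounds_antimono\<close>.\<close>

lemma game_length_antimono:
  assumes "S \<subseteq> T"
  shows "game_length p T \<le> game_length p S"
proof (cases "verts G \<subseteq> T")
  case True
  then show ?thesis by (simp add: game_length_def)
next
  case False
  then have "optimum p ((\<lambda>v. further_rounds (opponent p) (insert v T)) ` (verts G - T))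
      \<le> optimum p ((\<lambda>v. further_rounds (opponent p) (insert v S)) ` (verts G - S))"
    using assms by (intro optimum_selection_le further_rounds_antimono) auto
  then show ?thesis using False assms by (auto simp: game_length_def)
qed

end

theorem theorem2p4:
  fixes G :: "('a, 'b) pre_digraph"
  assumes "graph G"
    and "A \<subseteq> B" and "B \<subseteq> verts G"
  shows "graph.b\<^sub>g G B \<le> graph.b\<^sub>g G A"
  using assms by (simp add: graph.b\<^sub>g_def graph.game_length_antimono)

end
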